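(* For all formulas $\varphi,\psi$ of the logic $\mathbf{L}$, the following are provable in $\mathbf{L}$: (1a) $\varphi\sqcap\varphi\Rightarrow\varphi\sqcap(\varphi\vee\psi)$; (1b) $\varphi\sqcup(\varphi\wedge\psi)\Rightarrow\varphi\sqcup\varphi$; (2a) $\bot\Rightarrow\varphi$; (2b) $\varphi\Rightarrow\top$; (3a) $\neg\top\Rightarrow\bot$; (3b) $\top\Rightarrow\lrcorner\bot$; (4a) $\neg\bot\Leftrightarrow\top\sqcap\top$; (4b) $\lrcorner\top\Leftrightarrow\bot\sqcup\bot$.
   Context: Formulas of $\mathbf{L}$ are built from a countable set of propositional variables and constants $\top,\bot$ by $\varphi::=p\mid\neg\varphi\mid\lrcorner\varphi\mid\varphi\sqcap\varphi\mid\varphi\sqcup\varphi\mid\top\mid\bot$; abbreviate $\varphi\vee\psi:=\neg(\neg\varphi\sqcap\neg\psi)$ and $\varphi\wedge\psi:=\lrcorner(\lrcorner\varphi\sqcup\lrcorner\psi)$. Sequents have the form $\varphi\Rightarrow\psi$; $\varphi\Leftrightarrow\psi$ stands for the two sequents $\varphi\Rightarrow\psi$ and $\psi\Rightarrow\varphi$. Axioms of $\mathbf{L}$ (for all formulas $\varphi,\psi,\theta$): $\varphi\Rightarrow\varphi$; $\varphi\sqcap\psi\Rightarrow\varphi$; $\varphi\sqcap\psi\Rightarrow\psi$; $\varphi\Rightarrow\varphi\sqcup\psi$; $\psi\Rightarrow\varphi\sqcup\psi$; $\neg(\varphi\sqcap\varphi)\Rightarrow\neg\varphi$; $\lrcorner\varphi\Rightarrow\lrcorner(\varphi\sqcup\varphi)$;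 $\varphi\sqcap\neg\varphi\Leftrightarrow\bot$; $\top\Leftrightarrow\varphi\sqcup\lrcorner\varphi$; $\neg\neg(\varphi\sqcap\psi)\Leftrightarrow\varphi\sqcap\psi$; $\lrcorner\lrcorner(\varphi\sqcup\psi)\Leftrightarrow\varphi\sqcup\psi$; $\varphi\sqcap\varphi\Rightarrow\varphi\sqcap(\varphi\sqcup\psi)$; $\varphi\sqcup(\varphi\sqcap\psi)\Rightarrow\varphi\sqcup\varphi$; $\varphi\sqcap(\psi\vee\theta)\Leftrightarrow(\varphi\sqcap\psi)\vee(\varphi\sqcap\theta)$; $\varphi\sqcup(\psi\wedge\theta)\Leftrightarrow(\varphi\sqcup\psi)\wedge(\varphi\sqcup\theta)$; $(\varphi\sqcup\varphi)\sqcap(\varphi\sqcup\varphi)\Leftrightarrow(\varphi\sqcap\varphi)\sqcup(\varphi\sqcap\varphi)$. Rules: (Cut) from $\varphi\Rightarrow\psi$ and $\psi\Rightarrow\theta$ infer $\varphi\Rightarrow\theta$; from $\varphi\Rightarrow\psi$ infer each of $\varphi\sqcap\theta\Rightarrow\psi\sqcap\theta$, $\theta\sqcap\varphi\Rightarrow\theta\sqcap\psi$, $\varphi\sqcup\theta\Rightarrow\psi\sqcup\theta$, $\theta\sqcup\varphi\Rightarrow\theta\sqcup\psi$, $\neg\psi\Rightarrow\neg\varphi$, $\lrcorner\psi\Rightarrow\lrcorner\varphi$; ($\sqsubseteq$) from the four sequents $\varphi\sqcap\psi\Rightarrow\varphi\sqcap\varphi$, $\varphi\sqcap\varphi\Rightarrow\varphi\sqcap\psi$,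 $\varphi\sqcup\psi\Rightarrow\psi\sqcup\psi$, $\psi\sqcup\psi\Rightarrow\varphi\sqcup\psi$ infer $\varphi\Rightarrow\psi$. A sequent is provable if it is the last element of a finite sequence of sequents each of which is an axiom or follows from earlier ones by a rule. *)

theory Defs
  imports "HOL-Library.Countable"
begin

datatype 'v formula =
    Var 'v
  | Neg "'v formula"  (\<open>\<^bold>\<not> _\<close> [80] 80)
  | Opp "'v formula"  (\<open>\<^bold>\<rfloor> _\<close> [80] 80)
  | Meet "'v formula" "'v formula"  (infixl \<open>\<^bold>\<sqinter>\<close> 70)
  | Join "'v formula" "'v formula"  (infixl \<open>\<^bold>\<squnion>\<close> 65)
  | Top  (\<open>\<^bold>\<top>\<close>)
  | Bot  (\<open>\<^bold>\<bottom>\<close>)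

text \<open>\<open>\<^bold>\<rfloor>\<close> is the second negation, usually written with a lower right corner.
  \<open>\<^bold>\<or>\<close> and \<open>\<^bold>\<and>\<close> are derived connectives, distinct from
  \<open>\<^bold>\<squnion>\<close> and \<open>\<^bold>\<sqinter>\<close>.\<close>

abbreviation vee :: "'v formula \<Rightarrow> 'v formula \<Rightarrow> 'v formula"  (infixl \<open>\<^bold>\<or>\<close> 65)
  where "\<phi> \<^bold>\<or> \<psi> \<equiv> \<^bold>\<not> (\<^bold>\<not> \<phi> \<^bold>\<sqinter> \<^bold>\<not> \<psi>)"

abbreviation wedge :: "'v formula \<Rightarrow> 'v formula \<Rightarrow> 'v formula"  (infixl \<open>\<^bold>\<and>\<close> 70)
  where "\<phi> \<^bold>\<and> \<psi> \<equiv> \<^bold>\<rfloor> (\<^bold>\<rfloor> \<phi> \<^bold>\<squnion> \<^bold>\<rfloor> \<psi>)"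

datatype 'v sequent = Sequent "'v formula" "'v formula"  (infix \<open>\<^bold>\<Rightarrow>\<close> 50)

inductive L_axiom :: "'v sequent \<Rightarrow> bool" where
  ax_refl: "L_axiom (\<phi> \<^bold>\<Rightarrow> \<phi>)"
| ax_meet_left: "L_axiom (\<phi> \<^bold>\<sqinter> \<psi> \<^bold>\<Rightarrow> \<phi>)"
| ax_meet_right: "L_axiom (\<phi> \<^bold>\<sqinter> \<psi> \<^bold>\<Rightarrow> \<psi>)"
| ax_join_left: "L_axiom (\<phi> \<^bold>\<Rightarrow> \<phi> \<^bold>\<squnion> \<psi>)"
| ax_join_right: "L_axiom (\<psi> \<^bold>\<Rightarrow> \<phi> \<^bold>\<squnion> \<psi>)"
| ax_neg_meet: "L_axiom (\<^bold>\<not> (\<phi> \<^bold>\<sqinter> \<phi>) \<^bold>\<Rightarrow> \<^bold>\<not> \<phi>)"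
| ax_opp_join: "L_axiom (\<^bold>\<rfloor> \<phi> \<^bold>\<Rightarrow> \<^bold>\<rfloor> (\<phi> \<^bold>\<squnion> \<phi>))"
| ax_meet_neg_bot: "L_axiom (\<phi> \<^bold>\<sqinter> \<^bold>\<not> \<phi> \<^bold>\<Rightarrow> \<^bold>\<bottom>)"
| ax_bot_meet_neg: "L_axiom (\<^bold>\<bottom> \<^bold>\<Rightarrow> \<phi> \<^bold>\<sqinter> \<^bold>\<not> \<phi>)"
| ax_top_join_opp: "L_axiom (\<^bold>\<top> \<^bold>\<Rightarrow> \<phi> \<^bold>\<squnion> \<^bold>\<rfloor> \<phi>)"
| ax_join_opp_top: "L_axiom (\<phi> \<^bold>\<squnion> \<^bold>\<rfloor> \<phi> \<^bold>\<Rightarrow> \<^bold>\<top>)"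
| ax_neg_neg_elim: "L_axiom (\<^bold>\<not> \<^bold>\<not> (\<phi> \<^bold>\<sqinter> \<psi>) \<^bold>\<Rightarrow> \<phi> \<^bold>\<sqinter> \<psi>)"
| ax_neg_neg_intro: "L_axiom (\<phi> \<^bold>\<sqinter> \<psi> \<^bold>\<Rightarrow> \<^bold>\<not> \<^bold>\<not> (\<phi> \<^bold>\<sqinter> \<psi>))"
| ax_opp_opp_elim: "L_axiom (\<^bold>\<rfloor> \<^bold>\<rfloor> (\<phi> \<^bold>\<squnion> \<psi>) \<^bold>\<Rightarrow> \<phi> \<^bold>\<squnion> \<psi>)"
| ax_opp_opp_intro: "L_axiom (\<phi> \<^bold>\<squnion> \<psi> \<^bold>\<Rightarrow> \<^bold>\<rfloor> \<^bold>\<rfloor> (\<phi> \<^bold>\<squnion> \<psi>))"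
| ax_absorb_meet: "L_axiom (\<phi> \<^bold>\<sqinter> \<phi> \<^bold>\<Rightarrow> \<phi> \<^bold>\<sqinter> (\<phi> \<^bold>\<squnion> \<psi>))"
| ax_absorb_join: "L_axiom (\<phi> \<^bold>\<squnion> (\<phi> \<^bold>\<sqinter> \<psi>) \<^bold>\<Rightarrow> \<phi> \<^bold>\<squnion> \<phi>)"
| ax_distrib_meet: "L_axiom (\<phi> \<^bold>\<sqinter> (\<psi> \<^bold>\<or> \<theta>) \<^bold>\<Rightarrow> (\<phi> \<^bold>\<sqinter> \<psi>) \<^bold>\<or> (\<phi> \<^bold>\<sqinter> \<theta>))"
| ax_distrib_meet': "L_axiom ((\<phi> \<^bold>\<sqinter> \<psi>) \<^bold>\<or> (\<phi> \<^bold>\<sqinter> \<theta>) \<^bold>\<Rightarrow> \<phi> \<^bold>\<sqinter> (\<psi> \<^bold>\<or> \<theta>))"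
| ax_distrib_join: "L_axiom (\<phi> \<^bold>\<squnion> (\<psi> \<^bold>\<and> \<theta>) \<^bold>\<Rightarrow> (\<phi> \<^bold>\<squnion> \<psi>) \<^bold>\<and> (\<phi> \<^bold>\<squnion> \<theta>))"
| ax_distrib_join': "L_axiom ((\<phi> \<^bold>\<squnion> \<psi>) \<^bold>\<and> (\<phi> \<^bold>\<squnion> \<theta>) \<^bold>\<Rightarrow> \<phi> \<^bold>\<squnion> (\<psi> \<^bold>\<and> \<theta>))"
| ax_meet_join: "L_axiom ((\<phi> \<^bold>\<squnion> \<phi>) \<^bold>\<sqinter> (\<phi> \<^bold>\<squnion> \<phi>) \<^bold>\<Rightarrow> (\<phi> \<^bold>\<sqinter> \<phi>) \<^bold>\<squnion> (\<phi> \<^bold>\<sqinter> \<phi>))"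
| ax_join_meet: "L_axiom ((\<phi> \<^bold>\<sqinter> \<phi>) \<^bold>\<squnion> (\<phi> \<^bold>\<sqinter> \<phi>) \<^bold>\<Rightarrow> (\<phi> \<^bold>\<squnion> \<phi>) \<^bold>\<sqinter> (\<phi> \<^bold>\<squnion> \<phi>))"

text \<open>The first argument is the list of premises of a rule instance, the second its conclusion.\<close>

inductive L_rule :: "'v sequent list \<Rightarrow> 'v sequent \<Rightarrow> bool" where
  rule_cut: "L_rule [\<phi> \<^bold>\<Rightarrow> \<psi>, \<psi> \<^bold>\<Rightarrow> \<theta>] (\<phi> \<^bold>\<Rightarrow> \<theta>)"
| rule_meet_right: "L_rule [\<phi> \<^bold>\<Rightarrow> \<psi>] (\<phi> \<^bold>\<sqinter> \<theta> \<^bold>\<Rightarrow> \<psi> \<^bold>\<sqinter> \<theta>)"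
| rule_meet_left: "L_rule [\<phi> \<^bold>\<Rightarrow> \<psi>] (\<theta> \<^bold>\<sqinter> \<phi> \<^bold>\<Rightarrow> \<theta> \<^bold>\<sqinter> \<psi>)"
| rule_join_right: "L_rule [\<phi> \<^bold>\<Rightarrow> \<psi>] (\<phi> \<^bold>\<squnion> \<theta> \<^bold>\<Rightarrow> \<psi> \<^bold>\<squnion> \<theta>)"
| rule_join_left: "L_rule [\<phi> \<^bold>\<Rightarrow> \<psi>] (\<theta> \<^bold>\<squnion> \<phi> \<^bold>\<Rightarrow> \<theta> \<^bold>\<squnion> \<psi>)"
| rule_neg: "L_rule [\<phi> \<^bold>\<Rightarrow> \<psi>] (\<^bold>\<not> \<psi> \<^bold>\<Rightarrow> \<^bold>\<not> \<phi>)"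
| rule_opp: "L_rule [\<phi> \<^bold>\<Rightarrow> \<psi>] (\<^bold>\<rfloor> \<psi> \<^bold>\<Rightarrow> \<^bold>\<rfloor> \<phi>)"
| rule_order: "L_rule
    [\<phi> \<^bold>\<sqinter> \<psi> \<^bold>\<Rightarrow> \<phi> \<^bold>\<sqinter> \<phi>, \<phi> \<^bold>\<sqinter> \<phi> \<^bold>\<Rightarrow> \<phi> \<^bold>\<sqinter> \<psi>,
     \<phi> \<^bold>\<squnion> \<psi> \<^bold>\<Rightarrow> \<psi> \<^bold>\<squnion> \<psi>, \<psi> \<^bold>\<squnion> \<psi> \<^bold>\<Rightarrow> \<phi> \<^bold>\<squnion> \<psi>] (\<phi> \<^bold>\<Rightarrow> \<psi>)"

definition derivation :: "'v sequent list \<Rightarrow> bool" where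
  "derivation ss \<longleftrightarrow>
    (\<forall>i < length ss. L_axiom (ss ! i) \<or> (\<exists>ps. L_rule ps (ss ! i) \<and> set ps \<subseteq> set (take i ss)))"

definition provable :: "'v sequent \<Rightarrow> bool"  (\<open>\<^bold>\<turnstile> _\<close> [45] 45)
  where "\<^bold>\<turnstile> s \<longleftrightarrow> (\<exists>ss. ss \<noteq> [] \<and> derivation ss \<and> last ss = s)"

end

theory Submission
  imports Defs
begin

text \<open>Although \<open>\<phi> \<^bold>\<Rightarrow> \<phi> \<^bold>\<sqinter> \<phi>\<close> fails in general, it is provable when \<open>\<phi>\<close> is a meet or a
  \<open>\<^bold>\<not>\<close>-negation, because such formulas satisfy double negation introduction and \<open>\<^bold>\<not>\<close> does not
  distinguish \<open>\<phi>\<close> from \<open>\<phi> \<^bold>\<sqinter> \<phi>\<close>. Below such a formula \<open>\<^bold>\<sqinter>\<close> behaves as a genuine greatest lower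
  bound, and the claims (1a), (3a), (4a) become lattice computations.
  Dually, joins and \<open>\<^bold>\<rfloor>\<close>-negations satisfy \<open>\<phi> \<^bold>\<squnion> \<phi> \<^bold>\<Rightarrow> \<phi>\<close>.\<close>

text \<open>Rule applications refer to earlier sequents only through the set of entries before
  position \<open>i\<close>. Prefixing \<open>ss\<close> enlarges that set for every entry of
  \<open>ts\<close>, so each justification survives the shift.\<close>

lemma derivation_append:
  assumes "derivation ss" "derivation ts"
  shows "derivation (ss @ ts)"
  unfolding derivation_def
proof (intro allI impI)
  fix i assume i: "i < length (ss @ ts)"
  show "L_axiom ((ss @ ts) ! i) \<or>
    (\<exists>ps. L_rule ps ((ss @ ts) ! i) \<and> set ps \<subseteq> set (take i (ss @ ts)))"
  proof (cases "i < length ss")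
    case True
    then show ?thesis
      using assms(1) by (auto simp: derivation_def nth_append)
  next
    case False
    then have "i - length ss < length ts"
      using i by simp
    then show ?thesis
      using assms(2) False by (fastforce simp: derivation_def nth_append)
  qed
qed

lemma derivation_snoc:
  assumes "derivation ss" "L_axiom s \<or> (\<exists>ps. L_rule ps s \<and> set ps \<subseteq> set ss)"
  shows "derivation (ss @ [s])"
  using assms by (auto simp: derivation_def nth_append less_Suc_eq)

lemma provable_axiom: "L_axiom s \<Longrightarrow> \<^bold>\<turnstile> s"
  using derivation_snoc[of "[]" s] by (force simp: derivation_def provable_def)

text \<open>Every premise comes with its own derivation. Concatenating these gives a single one in
  which all premises occur, which is what the application of a rule requires.\<close>

lemma derivation_of_provables:
  assumes "\<And>p. p \<in> set ps \<Longrightarrow> \<^bold>\<turnstile> p"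
  obtains ss where "derivation ss" "set ps \<subseteq> set ss"
proof -
  have "\<exists>ss. derivation ss \<and> set ps \<subseteq> set ss"
    using assms
  proof (induction ps)
    case Nil
    show ?case by (simp add: derivation_def exI[of _ "[]"])
  next
    case (Cons p ps)
    then obtain ss where "derivation ss" "set ps \<subseteq> set ss"
      by auto
    moreover obtain ts where "derivation ts" "p \<in> set ts"
      using Cons.prems[of p] last_in_set by (auto simp: provable_def)
    ultimately show ?case
      by (intro exI[of _ "ss @ ts"]) (auto intro: derivation_append)
  qed
  then show thesis
    using that by blast
qed

text \<open>With \<open>provable_axiom\<close>, this lets provability be treated as an inductively
  closed relation; derivation sequences do not appear after this point.\<close>

lemma provable_rule:
  assumes "L_rule ps s" "\<And>p. p \<in> set ps \<Longrightarrow> \<^bold>\<turnstile> p"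
  shows "\<^bold>\<turnstile> s"
proof -
  obtain ss where "derivation ss" "set ps \<subseteq> set ss"
    using derivation_of_provables assms(2) by blast
  then have "derivation (ss @ [s])"
    using assms(1) by (blast intro: derivation_snoc)
  then show ?thesis
    unfolding provable_def by (intro exI[of _ "ss @ [s]"]) simp
qed

lemma provable_cut [trans]: "\<^bold>\<turnstile> \<phi> \<^bold>\<Rightarrow> \<psi> \<Longrightarrow> \<^bold>\<turnstile> \<psi> \<^bold>\<Rightarrow> \<theta> \<Longrightarrow> \<^bold>\<turnstile> \<phi> \<^bold>\<Rightarrow> \<theta>"
  by (rule provable_rule[OF rule_cut[of \<phi> \<psi> \<theta>]]) auto

lemma neg_antimono: "\<^bold>\<turnstile> \<phi> \<^bold>\<Rightarrow> \<psi> \<Longrightarrow> \<^bold>\<turnstile> \<^bold>\<not> \<psi> \<^bold>\<Rightarrow> \<^bold>\<not> \<phi>"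
  by (rule provable_rule[OF rule_neg]) auto

lemma opp_antimono: "\<^bold>\<turnstile> \<phi> \<^bold>\<Rightarrow> \<psi> \<Longrightarrow> \<^bold>\<turnstile> \<^bold>\<rfloor> \<psi> \<^bold>\<Rightarrow> \<^bold>\<rfloor> \<phi>"
  by (rule provable_rule[OF rule_opp]) auto

lemma meet_mono:
  assumes "\<^bold>\<turnstile> \<phi> \<^bold>\<Rightarrow> \<phi>'" "\<^bold>\<turnstile> \<psi> \<^bold>\<Rightarrow> \<psi>'"
  shows "\<^bold>\<turnstile> \<phi> \<^bold>\<sqinter> \<psi> \<^bold>\<Rightarrow> \<phi>' \<^bold>\<sqinter> \<psi>'"
proof -
  have "\<^bold>\<turnstile> \<phi> \<^bold>\<sqinter> \<psi> \<^bold>\<Rightarrow> \<phi>' \<^bold>\<sqinter> \<psi>"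
    using assms(1) by (auto intro: provable_rule[OF rule_meet_right])
  also have "\<^bold>\<turnstile> \<phi>' \<^bold>\<sqinter> \<psi> \<^bold>\<Rightarrow> \<phi>' \<^bold>\<sqinter> \<psi>'"
    using assms(2) by (auto intro: provable_rule[OF rule_meet_left])
  finally show ?thesis .
qed

lemma join_mono:
  assumes "\<^bold>\<turnstile> \<phi> \<^bold>\<Rightarrow> \<phi>'" "\<^bold>\<turnstile> \<psi> \<^bold>\<Rightarrow> \<psi>'"
  shows "\<^bold>\<turnstile> \<phi> \<^bold>\<squnion> \<psi> \<^bold>\<Rightarrow> \<phi>' \<^bold>\<squnion> \<psi>'"
proof -
  have "\<^bold>\<turnstile> \<phi> \<^bold>\<squnion> \<psi> \<^bold>\<Rightarrow> \<phi>' \<^bold>\<squnion> \<psi>"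
    using assms(1) by (auto intro: provable_rule[OF rule_join_right])
  also have "\<^bold>\<turnstile> \<phi>' \<^bold>\<squnion> \<psi> \<^bold>\<Rightarrow> \<phi>' \<^bold>\<squnion> \<psi>'"
    using assms(2) by (auto intro: provable_rule[OF rule_join_left])
  finally show ?thesis .
qed

text \<open>The copy of \<chi> is created under the double negation, where
  \<open>ax_neg_meet\<close> applies, and the double negation can then be removed because its
  argument has become a meet.\<close>

lemma meet_idem_if_neg_neg:
  assumes "\<^bold>\<turnstile> \<chi> \<^bold>\<Rightarrow> \<^bold>\<not> \<^bold>\<not> \<chi>"
  shows "\<^bold>\<turnstile> \<chi> \<^bold>\<Rightarrow> \<chi> \<^bold>\<sqinter> \<chi>"
proof -
  note assms
  also have "\<^bold>\<turnstile> \<^bold>\<not> \<^bold>\<not> \<chi> \<^bold>\<Rightarrow> \<^bold>\<not> \<^bold>\<not> (\<chi> \<^bold>\<sqinter> \<chi>)"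
    by (intro neg_antimono provable_axiom ax_neg_meet)
  also have "\<^bold>\<turnstile> \<^bold>\<not> \<^bold>\<not> (\<chi> \<^bold>\<sqinter> \<chi>) \<^bold>\<Rightarrow> \<chi> \<^bold>\<sqinter> \<chi>"
    by (intro provable_axiom ax_neg_neg_elim)
  finally show ?thesis .
qed

lemma join_idem_if_opp_opp:
  assumes "\<^bold>\<turnstile> \<^bold>\<rfloor> \<^bold>\<rfloor> \<chi> \<^bold>\<Rightarrow> \<chi>"
  shows "\<^bold>\<turnstile> \<chi> \<^bold>\<squnion> \<chi> \<^bold>\<Rightarrow> \<chi>"
proof -
  have "\<^bold>\<turnstile> \<chi> \<^bold>\<squnion> \<chi> \<^bold>\<Rightarrow> \<^bold>\<rfloor> \<^bold>\<rfloor> (\<chi> \<^bold>\<squnion> \<chi>)"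
    by (intro provable_axiom ax_opp_opp_intro)
  also have "\<^bold>\<turnstile> \<^bold>\<rfloor> \<^bold>\<rfloor> (\<chi> \<^bold>\<squnion> \<chi>) \<^bold>\<Rightarrow> \<^bold>\<rfloor> \<^bold>\<rfloor> \<chi>"
    by (intro opp_antimono provable_axiom ax_opp_join)
  also note assms
  finally show ?thesis .
qed

text \<open>Double negation elimination \<not>\<not>\<phi> \<Rightarrow> \<phi> holds for every
  \<phi>, by passing through \<phi> \<sqinter> \<phi>; negating it reverses the sequent.\<close>

lemma neg_neg_neg_intro: "\<^bold>\<turnstile> \<^bold>\<not> \<phi> \<^bold>\<Rightarrow> \<^bold>\<not> \<^bold>\<not> \<^bold>\<not> \<phi>"
proof -
  have "\<^bold>\<turnstile> \<^bold>\<not> \<^bold>\<not> \<phi> \<^bold>\<Rightarrow> \<^bold>\<not> \<^bold>\<not> (\<phi> \<^bold>\<sqinter> \<phi>)"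
    by (intro neg_antimono provable_axiom ax_neg_meet)
  also have "\<^bold>\<turnstile> \<^bold>\<not> \<^bold>\<not> (\<phi> \<^bold>\<sqinter> \<phi>) \<^bold>\<Rightarrow> \<phi> \<^bold>\<sqinter> \<phi>"
    by (intro provable_axiom ax_neg_neg_elim)
  also have "\<^bold>\<turnstile> \<phi> \<^bold>\<sqinter> \<phi> \<^bold>\<Rightarrow> \<phi>"
    by (intro provable_axiom ax_meet_left)
  finally show ?thesis
    by (rule neg_antimono)
qed

text \<open>Dually, \<phi> \<Rightarrow> \<rfloor>\<rfloor>\<phi> holds for every \<phi>, by passing
  through \<phi> \<squnion> \<phi>.\<close>

lemma opp_opp_opp_elim: "\<^bold>\<turnstile> \<^bold>\<rfloor> \<^bold>\<rfloor> \<^bold>\<rfloor> \<phi> \<^bold>\<Rightarrow> \<^bold>\<rfloor> \<phi>"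
proof -
  have "\<^bold>\<turnstile> \<phi> \<^bold>\<Rightarrow> \<phi> \<^bold>\<squnion> \<phi>"
    by (intro provable_axiom ax_join_left)
  also have "\<^bold>\<turnstile> \<phi> \<^bold>\<squnion> \<phi> \<^bold>\<Rightarrow> \<^bold>\<rfloor> \<^bold>\<rfloor> (\<phi> \<^bold>\<squnion> \<phi>)"
    by (intro provable_axiom ax_opp_opp_intro)
  also have "\<^bold>\<turnstile> \<^bold>\<rfloor> \<^bold>\<rfloor> (\<phi> \<^bold>\<squnion> \<phi>) \<^bold>\<Rightarrow> \<^bold>\<rfloor> \<^bold>\<rfloor> \<phi>"
    by (intro opp_antimono provable_axiom ax_opp_join)
  finally show ?thesis
    by (rule opp_antimono)
qed

text \<open>Monotonicity alone only bounds \<chi> \<sqinter> \<chi>. The double negation hypothesis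
  supplies the step from \<chi> to \<chi> \<sqinter> \<chi>.\<close>

lemma le_meetI:
  assumes "\<^bold>\<turnstile> \<chi> \<^bold>\<Rightarrow> \<^bold>\<not> \<^bold>\<not> \<chi>" "\<^bold>\<turnstile> \<chi> \<^bold>\<Rightarrow> \<phi>" "\<^bold>\<turnstile> \<chi> \<^bold>\<Rightarrow> \<psi>"
  shows "\<^bold>\<turnstile> \<chi> \<^bold>\<Rightarrow> \<phi> \<^bold>\<sqinter> \<psi>"
  using meet_idem_if_neg_neg[OF assms(1)] meet_mono[OF assms(2,3)] by (rule provable_cut)

lemma join_leI:
  assumes "\<^bold>\<turnstile> \<^bold>\<rfloor> \<^bold>\<rfloor> \<chi> \<^bold>\<Rightarrow> \<chi>" "\<^bold>\<turnstile> \<phi> \<^bold>\<Rightarrow> \<chi>" "\<^bold>\<turnstile> \<psi> \<^bold>\<Rightarrow> \<chi>"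
  shows "\<^bold>\<turnstile> \<phi> \<^bold>\<squnion> \<psi> \<^bold>\<Rightarrow> \<chi>"
  using join_mono[OF assms(2,3)] join_idem_if_opp_opp[OF assms(1)] by (rule provable_cut)

lemma bot_le: "\<^bold>\<turnstile> \<^bold>\<bottom> \<^bold>\<Rightarrow> \<phi>"
  by (rule provable_cut[OF provable_axiom[OF ax_bot_meet_neg] provable_axiom[OF ax_meet_left]])

lemma le_top: "\<^bold>\<turnstile> \<phi> \<^bold>\<Rightarrow> \<^bold>\<top>"
  by (rule provable_cut[OF provable_axiom[OF ax_join_left] provable_axiom[OF ax_join_opp_top]])

lemma meet_self_le_vee: "\<^bold>\<turnstile> \<phi> \<^bold>\<sqinter> \<phi> \<^bold>\<Rightarrow> \<phi> \<^bold>\<sqinter> (\<phi> \<^bold>\<or> \<psi>)"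
proof (rule le_meetI)
  show dn: "\<^bold>\<turnstile> \<phi> \<^bold>\<sqinter> \<phi> \<^bold>\<Rightarrow> \<^bold>\<not> \<^bold>\<not> (\<phi> \<^bold>\<sqinter> \<phi>)"
    by (intro provable_axiom ax_neg_neg_intro)
  show le: "\<^bold>\<turnstile> \<phi> \<^bold>\<sqinter> \<phi> \<^bold>\<Rightarrow> \<phi>"
    by (intro provable_axiom ax_meet_left)
  note dn
  also have "\<^bold>\<turnstile> \<^bold>\<not> \<^bold>\<not> (\<phi> \<^bold>\<sqinter> \<phi>) \<^bold>\<Rightarrow> \<^bold>\<not> \<^bold>\<not> \<phi>"
    by (intro neg_antimono le)
  \<comment> \<open>The derived disjunction is \<not>(\<not>\<phi> \<sqinter> \<not>\<psi>), so this
    is the negated projection of the inner meet onto \<not>\<phi>.\<close>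
  also have "\<^bold>\<turnstile> \<^bold>\<not> \<^bold>\<not> \<phi> \<^bold>\<Rightarrow> \<phi> \<^bold>\<or> \<psi>"
    by (intro neg_antimono provable_axiom ax_meet_left)
  finally show "\<^bold>\<turnstile> \<phi> \<^bold>\<sqinter> \<phi> \<^bold>\<Rightarrow> \<phi> \<^bold>\<or> \<psi>" .
qed

lemma wedge_le_join_self: "\<^bold>\<turnstile> \<phi> \<^bold>\<squnion> (\<phi> \<^bold>\<and> \<psi>) \<^bold>\<Rightarrow> \<phi> \<^bold>\<squnion> \<phi>"
proof (rule join_leI)
  show dn: "\<^bold>\<turnstile> \<^bold>\<rfloor> \<^bold>\<rfloor> (\<phi> \<^bold>\<squnion> \<phi>) \<^bold>\<Rightarrow> \<phi> \<^bold>\<squnion> \<phi>"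
    by (intro provable_axiom ax_opp_opp_elim)
  show le: "\<^bold>\<turnstile> \<phi> \<^bold>\<Rightarrow> \<phi> \<^bold>\<squnion> \<phi>"
    by (intro provable_axiom ax_join_left)
  have "\<^bold>\<turnstile> \<phi> \<^bold>\<and> \<psi> \<^bold>\<Rightarrow> \<^bold>\<rfloor> \<^bold>\<rfloor> \<phi>"
    by (intro opp_antimono provable_axiom ax_join_left)
  \<comment> \<open>The argument is enlarged to a join because \<open>dn\<close> removes the double
    \<rfloor> only there.\<close>
  also have "\<^bold>\<turnstile> \<^bold>\<rfloor> \<^bold>\<rfloor> \<phi> \<^bold>\<Rightarrow> \<^bold>\<rfloor> \<^bold>\<rfloor> (\<phi> \<^bold>\<squnion> \<phi>)"
    by (intro opp_antimono le)
  also note dn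
  finally show "\<^bold>\<turnstile> \<phi> \<^bold>\<and> \<psi> \<^bold>\<Rightarrow> \<phi> \<^bold>\<squnion> \<phi>" .
qed

text \<open>Both \<top> and \<not>\<top> are upper bounds of \<not>\<top>, which is a negation and
  hence lies below their meet, a contradiction.\<close>

lemma neg_top_le_bot: "\<^bold>\<turnstile> \<^bold>\<not> \<^bold>\<top> \<^bold>\<Rightarrow> \<^bold>\<bottom>"
proof -
  have "\<^bold>\<turnstile> \<^bold>\<not> \<^bold>\<top> \<^bold>\<Rightarrow> \<^bold>\<top> \<^bold>\<sqinter> \<^bold>\<not> \<^bold>\<top>"
    by (intro le_meetI neg_neg_neg_intro le_top provable_axiom ax_refl)
  also have "\<^bold>\<turnstile> \<^bold>\<top> \<^bold>\<sqinter> \<^bold>\<not> \<^bold>\<top> \<^bold>\<Rightarrow> \<^bold>\<bottom>"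
    by (intro provable_axiom ax_meet_neg_bot)
  finally show ?thesis .
qed

text \<open>Excluded middle for \<rfloor> at \<bottom> puts \<top> below \<bottom> \<squnion>
  \<rfloor>\<bottom>, and the disjunct \<bottom> is absorbed.\<close>

lemma top_le_opp_bot: "\<^bold>\<turnstile> \<^bold>\<top> \<^bold>\<Rightarrow> \<^bold>\<rfloor> \<^bold>\<bottom>"
proof -
  have "\<^bold>\<turnstile> \<^bold>\<top> \<^bold>\<Rightarrow> \<^bold>\<bottom> \<^bold>\<squnion> \<^bold>\<rfloor> \<^bold>\<bottom>"
    by (intro provable_axiom ax_top_join_opp)
  also have "\<^bold>\<turnstile> \<^bold>\<bottom> \<^bold>\<squnion> \<^bold>\<rfloor> \<^bold>\<bottom> \<^bold>\<Rightarrow> \<^bold>\<rfloor> \<^bold>\<bottom>"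
    by (intro join_leI opp_opp_opp_elim bot_le provable_axiom ax_refl)
  finally show ?thesis .
qed

lemma neg_bot_le: "\<^bold>\<turnstile> \<^bold>\<not> \<^bold>\<bottom> \<^bold>\<Rightarrow> \<^bold>\<top> \<^bold>\<sqinter> \<^bold>\<top>"
  by (intro le_meetI neg_neg_neg_intro le_top)

lemma le_neg_bot: "\<^bold>\<turnstile> \<^bold>\<top> \<^bold>\<sqinter> \<^bold>\<top> \<^bold>\<Rightarrow> \<^bold>\<not> \<^bold>\<bottom>"
  \<comment> \<open>The meet \<top> \<sqinter> \<top> lies below its double negation; negating
    \<bottom> \<Rightarrow> \<not>(\<top> \<sqinter> \<top>) leads from there to
    \<not>\<bottom>.\<close>
  by (rule provable_cut[OF provable_axiom[OF ax_neg_neg_intro] neg_antimono[OF bot_le]])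

lemma opp_top_le: "\<^bold>\<turnstile> \<^bold>\<rfloor> \<^bold>\<top> \<^bold>\<Rightarrow> \<^bold>\<bottom> \<^bold>\<squnion> \<^bold>\<bottom>"
  \<comment> \<open>Here \<open>le_top\<close> is used at \<rfloor>(\<bottom> \<squnion> \<bottom>),
    so that the double \<rfloor> stands before a join and can be removed.\<close>
  by (rule provable_cut[OF opp_antimono[OF le_top] provable_axiom[OF ax_opp_opp_elim]])

lemma le_opp_top: "\<^bold>\<turnstile> \<^bold>\<bottom> \<^bold>\<squnion> \<^bold>\<bottom> \<^bold>\<Rightarrow> \<^bold>\<rfloor> \<^bold>\<top>"
  by (intro join_leI opp_opp_opp_elim bot_le)

theorem theorem5p5:
  fixes \<phi> \<psi> :: "'v::countable formula"
  shows "(\<^bold>\<turnstile> \<phi> \<^bold>\<sqinter> \<phi> \<^bold>\<Rightarrow> \<phi> \<^bold>\<sqinter> (\<phi> \<^bold>\<or> \<psi>)) \<and>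
    (\<^bold>\<turnstile> \<phi> \<^bold>\<squnion> (\<phi> \<^bold>\<and> \<psi>) \<^bold>\<Rightarrow> \<phi> \<^bold>\<squnion> \<phi>) \<and>
    (\<^bold>\<turnstile> \<^bold>\<bottom> \<^bold>\<Rightarrow> \<phi>) \<and>
    (\<^bold>\<turnstile> \<phi> \<^bold>\<Rightarrow> \<^bold>\<top>) \<and>
    (\<^bold>\<turnstile> \<^bold>\<not> \<^bold>\<top> \<^bold>\<Rightarrow> (\<^bold>\<bottom> :: 'v formula)) \<and>
    (\<^bold>\<turnstile> \<^bold>\<top> \<^bold>\<Rightarrow> \<^bold>\<rfloor> (\<^bold>\<bottom> :: 'v formula)) \<and>
    (\<^bold>\<turnstile> \<^bold>\<not> \<^bold>\<bottom> \<^bold>\<Rightarrow> \<^bold>\<top> \<^bold>\<sqinter> (\<^bold>\<top> :: 'v formula)) \<and>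
    (\<^bold>\<turnstile> \<^bold>\<top> \<^bold>\<sqinter> \<^bold>\<top> \<^bold>\<Rightarrow> \<^bold>\<not> (\<^bold>\<bottom> :: 'v formula)) \<and>
    (\<^bold>\<turnstile> \<^bold>\<rfloor> \<^bold>\<top> \<^bold>\<Rightarrow> \<^bold>\<bottom> \<^bold>\<squnion> (\<^bold>\<bottom> :: 'v formula)) \<and>
    (\<^bold>\<turnstile> \<^bold>\<bottom> \<^bold>\<squnion> \<^bold>\<bottom> \<^bold>\<Rightarrow> \<^bold>\<rfloor> (\<^bold>\<top> :: 'v formula))"
  by (intro conjI meet_self_le_vee wedge_le_join_self bot_le le_top neg_top_le_bot top_le_opp_bot
      neg_bot_le le_neg_bot opp_top_le le_opp_top)

end
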